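(* Consider a joint system $(X,Y)$ evolving stochastically on a time interval $[0,T]$, with joint forward path measure $\mathbb P_{XY}$ and joint time-reversed path measure $\mathbb P^{\mathrm R}_{XY}$, and let $\mathbb P_X$ and $\mathbb P^{\mathrm R}_X$ be the corresponding marginal path measures of $X$. Define $$\Sigma_{XY}:=D_{\mathrm{KL}}(\mathbb P_{XY}\,\|\,\mathbb P^{\mathrm R}_{XY}),\qquad \Sigma_X:=D_{\mathrm{KL}}(\mathbb P_X\,\|\,\mathbb P^{\mathrm R}_X),\qquad \Sigma^{(X)}_{\mathrm{hidden}}:=\Sigma_{XY}-\Sigma_X .$$ Assume that the joint and marginal path measures admit densities with respect to common reference measures, and that conditional path measures $\mathbb P_{Y|X}$ and $\mathbb P^{\mathrm R}_{Y|X}$ (of the $Y$-path given the $X$-path) exist. Then $$\Sigma^{(X)}_{\mathrm{hidden}}=\int D_{\mathrm{KL}}\bigl(\mathbb P_{Y|X=\gamma}\,\big\|\,\mathbb P^{\mathrm R}_{Y|X=\gamma}\bigr)\,\mathbb P_X(\mathrm d\gamma)\;\ge\;0 ,$$ where $\gamma$ ranges over the paths of $X$.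
   Context: $D_{\mathrm{KL}}(\mu\,\|\,\nu)=\int\log\frac{\mathrm d\mu}{\mathrm d\nu}\,\mathrm d\mu$ denotes the Kullback–Leibler divergence. A path measure is the probability law of the trajectory of a stochastic process on $[0,T]$; the time-reversed path measure is the one induced by the time-reversal map on paths. The conditional path measures satisfy $\mathrm d\mathbb P_{XY}=\mathrm d\mathbb P_X\,\mathrm d\mathbb P_{Y|X}$ and $\mathrm d\mathbb P^{\mathrm R}_{XY}=\mathrm d\mathbb P^{\mathrm R}_X\,\mathrm d\mathbb P^{\mathrm R}_{Y|X}$. The quantity $\Sigma^{(X)}_{\mathrm{hidden}}$ is called the hidden dissipation: the part of the joint dissipation $\Sigma_{XY}$ that is invisible from the subsystem $X$.
   Formalization: The sigma-algebra on the Y-paths is assumed countably generated (otherwise conditional path measures need not be a.e. unique and the identity can fail), and the dissipations of the joint system and of X are assumed not both infinite, so that the hidden dissipation is defined. *)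

theory Defs
  imports "HOL-Probability.Probability"
begin

section \<open>Relative entropy with values in the extended reals\<close>

text \<open>
  The integral of an extended-real function as the difference of the integrals of its positive and
  negative parts. It is meaningful only if at least one of the two is finite; otherwise the value
  is the junk value \<open>\<infinity> - \<infinity> = \<infinity>\<close> of \<^typ>\<open>ereal\<close>.
\<close>

definition eintegral :: "'a measure \<Rightarrow> ('a \<Rightarrow> ereal) \<Rightarrow> ereal" where
  "eintegral M f =
     enn2ereal (\<integral>\<^sup>+x. e2ennreal (f x) \<partial>M) - enn2ereal (\<integral>\<^sup>+x. e2ennreal (- f x) \<partial>M)"

text \<open>
  The divergence of \<open>\<mu>\<close> from \<open>\<nu>\<close>, with the natural logarithm. The library's
  \<^const>\<open>KL_divergence\<close> takes the reference measure first and is real-valued, so it returns junk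
  when \<open>\<mu>\<close> is not absolutely continuous with respect to \<open>\<nu>\<close> or the log-density is not integrable;
  here the value is then \<open>\<infinity>\<close>. For probability measures the negative part of the
  log-density is always integrable.
\<close>

definition kl_div :: "'a measure \<Rightarrow> 'a measure \<Rightarrow> ereal" where
  "kl_div \<mu> \<nu> =
     (if absolutely_continuous \<nu> \<mu>
      then eintegral \<mu> (\<lambda>x. ereal (entropy_density (exp 1) \<nu> \<mu> x))
      else \<infinity>)"

lemma eintegral_ereal:
  assumes "integrable M f"
  shows "eintegral M (\<lambda>x. ereal (f x)) = ereal (integral\<^sup>L M f)"
proof -
  have fin: "(\<integral>\<^sup>+x. ennreal (f x) \<partial>M) \<noteq> \<infinity>" "(\<integral>\<^sup>+x. ennreal (- f x) \<partial>M) \<noteq> \<infinity>"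
    using assms by (auto simp: real_integrable_def)
  have *: "enn2ereal a = ereal (enn2real a)" if "a \<noteq> \<infinity>" for a
    using that by (cases a) (auto simp: enn2ereal_ennreal)
  show ?thesis
    unfolding eintegral_def real_lebesgue_integral_def[OF assms]
    using fin by (simp add: * flip: ennreal.abs_eq)
qed

lemma kl_div_eq_KL_divergence:
  assumes "absolutely_continuous \<nu> \<mu>" "integrable \<mu> (entropy_density (exp 1) \<nu> \<mu>)"
  shows "kl_div \<mu> \<nu> = ereal (KL_divergence (exp 1) \<nu> \<mu>)"
  using assms by (simp add: kl_div_def KL_divergence_def eintegral_ereal)

section \<open>Path spaces and path measures\<close>

definition trajectory :: "real \<Rightarrow> (real \<Rightarrow> 'w \<Rightarrow> 'a) \<Rightarrow> 'w \<Rightarrow> (real \<Rightarrow> 'a)" where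
  "trajectory T X \<omega> = (\<lambda>t\<in>{0..T}. X t \<omega>)"

definition time_reversal :: "real \<Rightarrow> (real \<Rightarrow> 'a) \<Rightarrow> (real \<Rightarrow> 'a)" where
  "time_reversal T \<gamma> = (\<lambda>t\<in>{0..T}. \<gamma> (T - t))"

text \<open>
  A measurable space \<open>E\<close> of paths on \<open>{0..T}\<close> in the state space \<open>S\<close>; only the measurable
  structure of \<open>S\<close> and \<open>E\<close> is used. Leaving \<open>E\<close> open admits the full product \<open>\<sigma>\<close>-algebra as well as
  smaller spaces of regular paths, such as continuous ones.
\<close>

locale path_space =
  fixes T :: real and S :: "'a measure" and E :: "(real \<Rightarrow> 'a) measure"
  assumes horizon_pos: "0 < T"
    and space_subset: "space E \<subseteq> {0..T} \<rightarrow>\<^sub>E space S"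
    and measurable_eval: "\<And>t. t \<in> {0..T} \<Longrightarrow> (\<lambda>\<gamma>. \<gamma> t) \<in> measurable E S"
    and measurable_reversal: "time_reversal T \<in> measurable E E"

lemma path_space_PiM:
  assumes "0 < T"
  shows "path_space T S (PiM {0..T} (\<lambda>_. S))"
proof
  show "time_reversal T \<in> measurable (PiM {0..T} (\<lambda>_. S)) (PiM {0..T} (\<lambda>_. S))"
    unfolding time_reversal_def by (rule measurable_restrict) auto
qed (use assms in \<open>auto simp: space_PiM\<close>)

definition joint_path_measure ::
  "real \<Rightarrow> 'w measure \<Rightarrow> (real \<Rightarrow> 'a) measure \<Rightarrow> (real \<Rightarrow> 'b) measure \<Rightarrow>
   (real \<Rightarrow> 'w \<Rightarrow> 'a) \<Rightarrow> (real \<Rightarrow> 'w \<Rightarrow> 'b) \<Rightarrow> ((real \<Rightarrow> 'a) \<times> (real \<Rightarrow> 'b)) measure" where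
  "joint_path_measure T \<Omega> FX FY X Y =
     distr \<Omega> (FX \<Otimes>\<^sub>M FY) (\<lambda>\<omega>. (trajectory T X \<omega>, trajectory T Y \<omega>))"

definition reversed_measure ::
  "real \<Rightarrow> ((real \<Rightarrow> 'a) \<times> (real \<Rightarrow> 'b)) measure \<Rightarrow> ((real \<Rightarrow> 'a) \<times> (real \<Rightarrow> 'b)) measure" where
  "reversed_measure T P = distr P P (map_prod (time_reversal T) (time_reversal T))"

definition marginal_X :: "'x measure \<Rightarrow> ('x \<times> 'y) measure \<Rightarrow> 'x measure" where
  "marginal_X FX P = distr P FX fst"

section \<open>Densities and conditional measures\<close>

definition has_density_wrt :: "'a measure \<Rightarrow> 'a measure \<Rightarrow> bool" where
  "has_density_wrt P R \<longleftrightarrow> (\<exists>f \<in> borel_measurable R. P = density R f)"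

text \<open>
  \<open>K\<close> is a version of the conditional law of the second component given the first: a Markov
  kernel with \<open>dP(x,y) = dP\<^sub>X(x) K(x,dy)\<close>, where \<open>P\<^sub>X\<close> is the first marginal of \<open>P\<close>.
\<close>

definition is_conditional ::
  "'x measure \<Rightarrow> 'y measure \<Rightarrow> ('x \<times> 'y) measure \<Rightarrow> ('x \<Rightarrow> 'y measure) \<Rightarrow> bool" where
  "is_conditional FX FY P K \<longleftrightarrow>
     K \<in> measurable FX (prob_algebra FY) \<and>
     (\<forall>A \<in> sets (FX \<Otimes>\<^sub>M FY).
        emeasure P A = (\<integral>\<^sup>+x. emeasure (K x) (Pair x -` A) \<partial>(marginal_X FX P)))"

text \<open>
  Conditional laws on a measurable space that is not countably generated need not be unique up to
  null sets: let \<open>U\<close> be uniform on \<open>[0,1]\<close> and \<open>X\<^sub>t = U\<close> for all \<open>t\<close>. On the full product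
  \<open>\<sigma>\<close>-algebra the point mass at the zero path and the point mass at the path \<open>t \<mapsto> of_bool (t = U)\<close>
  are both conditional laws of \<open>Y = 0\<close> given \<open>X\<close>, and they are mutually singular.
\<close>

definition countably_generated :: "'a measure \<Rightarrow> bool" where
  "countably_generated M \<longleftrightarrow>
     (\<exists>G. countable G \<and> G \<subseteq> Pow (space M) \<and> sets M = sigma_sets (space M) G)"

end

theory Submission
  imports Defs
begin

section \<open>Extended-real integrals and divergences\<close>

text \<open>
  The statement is the chain rule of relative entropy, and time reversal plays no role in it.
  If the joint law \<open>P\<close> has density \<open>f\<close> with respect to its reversal \<open>Q\<close>, and the marginals have
  density \<open>g\<close>, then \<open>g x * K x B\<close> and the integral of \<open>f (x, _)\<close> over \<open>B\<close> against \<open>L x\<close> agree for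
  almost every \<open>x\<close>, simultaneously for all \<open>B\<close> in a countable generating \<open>\<inter>\<close>-stable system. Hence
  \<open>K x\<close> has density \<open>f (x, _) / g x\<close> with respect to \<open>L x\<close>, and integrating
  \<open>ln f = ln g + ln (f / g)\<close> against \<open>P\<close> gives the claim; each logarithm has an integrable negative
  part, so the integrals add in \<^typ>\<open>ereal\<close>. If \<open>P\<close> is not absolutely continuous with respect to
  \<open>Q\<close> but the divergence of the marginals is finite, both sides are infinite.
\<close>

lemma eintegral_cong_AE:
  assumes "AE x in M. f x = g x"
  shows "eintegral M f = eintegral M g"
proof -
  have "(\<integral>\<^sup>+x. e2ennreal (f x) \<partial>M) = (\<integral>\<^sup>+x. e2ennreal (g x) \<partial>M)"
    "(\<integral>\<^sup>+x. e2ennreal (- f x) \<partial>M) = (\<integral>\<^sup>+x. e2ennreal (- g x) \<partial>M)"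
    by (rule nn_integral_cong_AE, use assms in eventually_elim, simp)+
  then show ?thesis
    by (simp add: eintegral_def)
qed

lemma eintegral_ereal_def:
  "eintegral M (\<lambda>x. ereal (f x)) =
     enn2ereal (\<integral>\<^sup>+x. ennreal (f x) \<partial>M) - enn2ereal (\<integral>\<^sup>+x. ennreal (- f x) \<partial>M)"
  by (simp add: eintegral_def flip: ennreal.abs_eq)

text \<open>Subtraction on \<open>ennreal\<close> is cut off at 0 and subtraction on
  \<open>ereal\<close> is not, hence the condition \<open>b \<le> a\<close>.\<close>

lemma enn2ereal_diff:
  assumes "b \<le> a" "b \<noteq> \<infinity>"
  shows "enn2ereal (a - b) = enn2ereal a - enn2ereal b"
  using assms by (cases a; cases b) (auto simp: ennreal_minus enn2ereal_ennreal)

lemma eintegral_nonneg_fun: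
  assumes "AE x in M. 0 \<le> f x"
  shows "eintegral M f = enn2ereal (\<integral>\<^sup>+x. e2ennreal (f x) \<partial>M)"
proof -
  have "(\<integral>\<^sup>+x. e2ennreal (- f x) \<partial>M) = (\<integral>\<^sup>+x. 0 \<partial>M)"
    by (rule nn_integral_cong_AE, use assms in eventually_elim, simp add: e2ennreal_neg)
  then show ?thesis
    by (simp add: eintegral_def zero_ennreal.rep_eq)
qed

text \<open>Moving all negative parts across \<open>w = u + v\<close> leaves an identity in
  \<open>ennreal\<close>, where infinite positive parts do no harm. The negative part of
  \<open>w\<close> is bounded by those of \<open>u\<close> and \<open>v\<close>, so all three are
  finite and can be moved back after integration.\<close>

lemma eintegral_add:
  fixes u v w :: "'a \<Rightarrow> real"
  assumes [measurable]: "u \<in> borel_measurable M" "v \<in> borel_measurable M" "w \<in> borel_measurable M"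
    and add: "AE x in M. w x = u x + v x"
    and fin: "(\<integral>\<^sup>+x. ennreal (- u x) \<partial>M) \<noteq> \<infinity>" "(\<integral>\<^sup>+x. ennreal (- v x) \<partial>M) \<noteq> \<infinity>"
  shows "eintegral M (\<lambda>x. ereal (w x)) = eintegral M (\<lambda>x. ereal (u x)) + eintegral M (\<lambda>x. ereal (v x))"
proof -
  let ?p = "\<lambda>f. \<integral>\<^sup>+x. ennreal (f x) \<partial>M" and ?n = "\<lambda>f. \<integral>\<^sup>+x. ennreal (- f x) \<partial>M"
  have "?n w \<le> (\<integral>\<^sup>+x. ennreal (- u x) + ennreal (- v x) \<partial>M)"
    by (rule nn_integral_mono_AE, use add in eventually_elim)
      (auto simp: ennreal_plus_if ennreal_leI)
  then have le: "?n w \<le> ?n u + ?n v"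
    by (simp add: nn_integral_add)
  have "(\<integral>\<^sup>+x. ennreal (w x) + (ennreal (- u x) + ennreal (- v x)) \<partial>M) =
      (\<integral>\<^sup>+x. ennreal (- w x) + (ennreal (u x) + ennreal (v x)) \<partial>M)"
  proof (rule nn_integral_cong_AE, use add in eventually_elim)
    case (elim x)
    have eq: "max 0 (w x) + (max 0 (- u x) + max 0 (- v x)) =
        max 0 (- w x) + (max 0 (u x) + max 0 (v x))"
      using elim by auto
    have "ennreal (max 0 (w x) + (max 0 (- u x) + max 0 (- v x))) =
        ennreal (max 0 (- w x) + (max 0 (u x) + max 0 (v x)))"
      by (simp only: eq)
    then show ?case
      by (simp add: ennreal_plus)
  qed
  then have "?p w + (?n u + ?n v) = ?n w + (?p u + ?p v)"
    by (simp add: nn_integral_add)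
  moreover from le fin have "?n w \<noteq> \<infinity>"
    by (auto simp: top_unique)
  ultimately show ?thesis
    unfolding eintegral_ereal_def using fin
    by (cases "?p u"; cases "?p v"; cases "?p w"; cases "?n u"; cases "?n v"; cases "?n w")
      (auto simp: enn2ereal_ennreal simp flip: ennreal_plus)
qed

section \<open>Log-densities between probability measures\<close>

context
  fixes \<mu> \<nu> :: "'a measure" and h :: "'a \<Rightarrow> real"
  assumes prob: "prob_space \<mu>" "prob_space \<nu>"
    and h [measurable]: "h \<in> borel_measurable \<nu>"
    and h_nonneg: "\<And>x. 0 \<le> h x"
    and density: "\<mu> = density \<nu> (\<lambda>x. ennreal (h x))"
begin

interpretation \<mu>: prob_space \<mu> by (rule prob)
interpretation \<nu>: prob_space \<nu> by (rule prob)

text \<open>A measure gives no mass to the zero set of its own density.\<close>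

lemma AE_density_pos: "AE x in \<mu>. 0 < h x"
  unfolding density by (subst AE_density) auto

text \<open>Two versions of the density differ on a \<open>\<nu>\<close>-null set, which absolute
  continuity makes \<open>\<mu>\<close>-null, so any version computes the divergence.\<close>

lemma kl_div_density: "kl_div \<mu> \<nu> = eintegral \<mu> (\<lambda>x. ereal (ln (h x)))"
proof -
  have sets: "sets \<mu> = sets \<nu>"
    by (simp add: density)
  have ac: "absolutely_continuous \<nu> \<mu>"
    unfolding density by (rule absolutely_continuousI_density) simp
  have "AE x in \<nu>. ennreal (h x) = RN_deriv \<nu> \<mu> x"
    by (rule \<nu>.RN_deriv_unique) (auto simp: density)
  then have "AE x in \<mu>. ennreal (h x) = RN_deriv \<nu> \<mu> x"
    by (rule absolutely_continuous_AE[OF sets ac])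
  then have "AE x in \<mu>. ereal (entropy_density (exp 1) \<nu> \<mu> x) = ereal (ln (h x))"
    by eventually_elim
      (metis comp_apply enn2real_ennreal entropy_density_def h_nonneg log_ln)
  then show ?thesis
    unfolding kl_div_def using ac by (simp add: eintegral_cong_AE)
qed

text \<open>For \<open>h > 0\<close> one has \<open>h * ln (1 / h) \<le> 1 - h \<le> 1\<close>, and
  \<open>\<nu>\<close> has mass 1. This bound keeps the integrals of log-densities away from
  \<open>\<infinity> - \<infinity>\<close>.\<close>

lemma nn_integral_ln_density_neg: "(\<integral>\<^sup>+x. ennreal (- ln (h x)) \<partial>\<mu>) \<le> 1"
proof -
  have "h x * max 0 (- ln (h x)) \<le> 1" for x
  proof (cases "0 < h x")
    case True
    then have "h x * ln (1 / h x) \<le> h x * (1 / h x - 1)"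
      by (intro mult_left_mono ln_le_minus_one) auto
    with True show ?thesis
      by (auto simp: max_def ln_div algebra_simps)
  qed (use h_nonneg[of x] in auto)
  then have "ennreal (h x) * ennreal (- ln (h x)) \<le> 1" for x
    by (metis ennreal_le_1 ennreal_max_0 ennreal_mult h_nonneg max.cobounded1)
  then have "(\<integral>\<^sup>+x. ennreal (h x) * ennreal (- ln (h x)) \<partial>\<nu>) \<le> (\<integral>\<^sup>+x. 1 \<partial>\<nu>)"
    by (rule nn_integral_mono)
  then show ?thesis
    by (simp add: density nn_integral_density \<nu>.emeasure_space_1)
qed

text \<open>Integrates \<open>h - 1 \<le> h ln h\<close>, with the negative parts moved across to stay in \<^typ>\<open>ennreal\<close>.\<close>

lemma nn_integral_ln_density_neg_le_pos:
  "(\<integral>\<^sup>+x. ennreal (- ln (h x)) \<partial>\<mu>) \<le> (\<integral>\<^sup>+x. ennreal (ln (h x)) \<partial>\<mu>)"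
proof -
  have le: "ennreal (h x) * ennreal (- ln (h x)) + ennreal (h x) \<le>
      ennreal (h x) * ennreal (ln (h x)) + 1" for x
  proof -
    have "h x * max 0 (- ln (h x)) + h x \<le> h x * max 0 (ln (h x)) + 1"
    proof (cases "0 < h x")
      case True
      then have "h x * ln (1 / h x) \<le> h x * (1 / h x - 1)"
        by (intro mult_left_mono ln_le_minus_one) auto
      with True show ?thesis
        by (auto simp: max_def ln_div algebra_simps)
    qed (use h_nonneg[of x] in auto)
    then have "ennreal (h x * max 0 (- ln (h x)) + h x) \<le> ennreal (h x * max 0 (ln (h x)) + 1)"
      by (rule ennreal_leI)
    then show ?thesis
      using h_nonneg[of x] by (simp add: ennreal_plus ennreal_mult)
  qed
  have "(\<integral>\<^sup>+x. ennreal (h x) \<partial>\<nu>) = emeasure \<mu> (space \<mu>)"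
    by (simp add: density emeasure_density cong: nn_integral_cong)
  then have one: "(\<integral>\<^sup>+x. ennreal (h x) \<partial>\<nu>) = 1"
    by (simp add: \<mu>.emeasure_space_1)
  have "(\<integral>\<^sup>+x. ennreal (h x) * ennreal (- ln (h x)) + ennreal (h x) \<partial>\<nu>) \<le>
      (\<integral>\<^sup>+x. ennreal (h x) * ennreal (ln (h x)) + 1 \<partial>\<nu>)"
    by (intro nn_integral_mono le)
  then have "(\<integral>\<^sup>+x. ennreal (- ln (h x)) \<partial>\<mu>) + 1 \<le> (\<integral>\<^sup>+x. ennreal (ln (h x)) \<partial>\<mu>) + 1"
    by (simp add: density nn_integral_density nn_integral_add \<nu>.emeasure_space_1 one)
  then show ?thesis
    by (simp add: add.commute[of _ 1])
qed

end

text \<open>Replaces the \<open>ennreal\<close>-valued Radon-Nikodym derivative by a real function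
  that is nonnegative everywhere, so that \<open>ln\<close> applies to it.\<close>

lemma prob_density_exists:
  assumes "prob_space \<mu>" "prob_space \<nu>" "sets \<mu> = sets \<nu>" "absolutely_continuous \<nu> \<mu>"
  obtains h :: "'a \<Rightarrow> real" where "h \<in> borel_measurable \<nu>" "\<And>x. 0 \<le> h x"
    "\<mu> = density \<nu> (\<lambda>x. ennreal (h x))"
proof -
  interpret \<mu>: prob_space \<mu> by fact
  interpret \<nu>: prob_space \<nu> by fact
  obtain D :: "'a \<Rightarrow> real" where D: "D \<in> borel_measurable \<nu>"
    "AE x in \<nu>. RN_deriv \<nu> \<mu> x = ennreal (D x)" "\<And>x. 0 \<le> D x"
    using \<nu>.real_RN_deriv[OF \<mu>.finite_measure_axioms assms(4,3)] by metis
  have "\<mu> = density \<nu> (RN_deriv \<nu> \<mu>)"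
    using \<nu>.density_RN_deriv[OF assms(4,3)] by simp
  also have "\<dots> = density \<nu> (\<lambda>x. ennreal (D x))"
    using D by (intro density_cong) auto
  finally show ?thesis
    using D that by blast
qed

text \<open>Gibbs' inequality: the positive part of the log-density dominates the negative part,
  which is finite. Without absolute continuity the value is \<open>\<infinity>\<close>.\<close>

lemma kl_div_nonneg:
  assumes "prob_space \<mu>" "prob_space \<nu>" "sets \<mu> = sets \<nu>"
  shows "0 \<le> kl_div \<mu> \<nu>"
proof (cases "absolutely_continuous \<nu> \<mu>")
  case True
  then obtain h :: "'a \<Rightarrow> real" where h: "h \<in> borel_measurable \<nu>" "\<And>x. 0 \<le> h x"
    "\<mu> = density \<nu> (\<lambda>x. ennreal (h x))"
    using prob_density_exists[OF assms] by metis
  show ?thesis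
    unfolding kl_div_density[OF assms(1,2) h] eintegral_ereal_def
    using nn_integral_ln_density_neg_le_pos[OF assms(1,2) h]
      nn_integral_ln_density_neg[OF assms(1,2) h]
    by (subst enn2ereal_diff[symmetric]) (auto simp: top_unique)
qed (simp add: kl_div_def)

text \<open>Finite intersections of generators are still countably many. Countability lets
  exceptional null sets be merged; stability under intersection lets equality of measures extend
  from \<open>G\<close> to the whole \<sigma>-algebra.\<close>

lemma countably_generated_Int_stable:
  assumes "countably_generated M"
  obtains G where "countable G" "G \<subseteq> Pow (space M)" "Int_stable G" "space M \<in> G"
    "sets M = sigma_sets (space M) G"
proof -
  obtain G where G: "countable G" "G \<subseteq> Pow (space M)" "sets M = sigma_sets (space M) G"
    using assms by (auto simp: countably_generated_def)
  \<comment> \<open>The empty family has intersection \<open>UNIV\<close>; cutting with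
    \<open>space M\<close> turns it into \<open>space M\<close>, which puts the whole space into
    \<open>H\<close>.\<close>
  define H where "H = (\<lambda>F. space M \<inter> \<Inter>F) ` {F. finite F \<and> F \<subseteq> G}"
  have "countable H"
    unfolding H_def using countable_Collect_finite_subset[OF G(1)] by simp
  moreover have "H \<subseteq> Pow (space M)"
    by (auto simp: H_def)
  moreover have "Int_stable H"
  proof (rule Int_stableI)
    fix A B assume "A \<in> H" "B \<in> H"
    then obtain F F' where "finite F" "F \<subseteq> G" "finite F'" "F' \<subseteq> G"
      "A = space M \<inter> \<Inter>F" "B = space M \<inter> \<Inter>F'"
      by (auto simp: H_def)
    then show "A \<inter> B \<in> H"
      unfolding H_def by (intro image_eqI[of _ _ "F \<union> F'"]) auto
  qed
  moreover have "space M \<in> H"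
    unfolding H_def by (intro image_eqI[of _ _ "{}"]) auto
  moreover have "sets M = sigma_sets (space M) H"
  proof
    have "G \<subseteq> H"
    proof
      fix A assume "A \<in> G"
      then show "A \<in> H"
        unfolding H_def using G(2) by (intro image_eqI[of _ _ "{A}"]) auto
    qed
    then show "sets M \<subseteq> sigma_sets (space M) H"
      unfolding G(3) by (rule sigma_sets_mono')
    have "H \<subseteq> sets M"
    proof
      fix A assume "A \<in> H"
      then obtain F where F: "finite F" "F \<subseteq> G" "A = space M \<inter> \<Inter>F"
        by (auto simp: H_def)
      moreover have "F \<subseteq> sets M"
        using F(2) unfolding G(3) by auto
      ultimately show "A \<in> sets M"
        using sets.finite_INT[of F "\<lambda>x. x" M] by (cases "F = {}") auto
    qed
    then show "sigma_sets (space M) H \<subseteq> sets M"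
      by (rule sets.sigma_sets_subset)
  qed
  ultimately show ?thesis
    using that by blast
qed

section \<open>Disintegration along the first marginal\<close>

locale disintegrated =
  fixes FX :: "'x measure" and FY :: "'y measure" and P :: "('x \<times> 'y) measure"
    and K :: "'x \<Rightarrow> 'y measure"
  assumes prob: "prob_space P"
    and sets_P [measurable_cong]: "sets P = sets (FX \<Otimes>\<^sub>M FY)"
    and cond: "is_conditional FX FY P K"
begin

sublocale prob_space P by (rule prob)

abbreviation PX where "PX \<equiv> marginal_X FX P"

lemma sets_PX [measurable_cong, simp]: "sets PX = sets FX"
  by (simp add: marginal_X_def)

lemma space_PX [simp]: "space PX = space FX"
  by (simp add: marginal_X_def)

lemma prob_PX: "prob_space PX"
  unfolding marginal_X_def by (rule prob_space_distr) measurable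

lemma kernel_prob [measurable]: "K \<in> measurable FX (prob_algebra FY)"
  using cond by (simp add: is_conditional_def)

lemma kernel [measurable]: "K \<in> measurable FX (subprob_algebra FY)"
  by (rule measurable_prob_algebraD) measurable

lemma prob_conditional: "x \<in> space FX \<Longrightarrow> prob_space (K x)"
  and sets_conditional: "x \<in> space FX \<Longrightarrow> sets (K x) = sets FY"
  using measurable_space[OF kernel_prob] by (auto simp: space_prob_algebra)

lemma space_conditional: "x \<in> space FX \<Longrightarrow> space (K x) = space FY"
  using sets_conditional by (rule sets_eq_imp_space_eq)

lemma measurable_nn_integral_kernel [measurable]:
  assumes "f \<in> borel_measurable (FX \<Otimes>\<^sub>M FY)"
  shows "(\<lambda>x. \<integral>\<^sup>+y. f (x, y) \<partial>K x) \<in> borel_measurable FX"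
  using assms by (intro nn_integral_measurable_subprob_algebra2[of _ _ FY]) auto

text \<open>\<open>is_conditional\<close> gives this for sets only. It lifts to functions by
  recognising \<open>P\<close> as the monadic composition of its marginal with the kernel sending
  \<open>x\<close> to the law of \<open>(x, y)\<close>, \<open>y\<close> drawn from
  \<open>K x\<close>.\<close>

lemma nn_integral_disintegrate:
  assumes f [measurable]: "f \<in> borel_measurable (FX \<Otimes>\<^sub>M FY)"
  shows "(\<integral>\<^sup>+z. f z \<partial>P) = (\<integral>\<^sup>+x. \<integral>\<^sup>+y. f (x, y) \<partial>K x \<partial>PX)"
proof -
  let ?N = "\<lambda>x. distr (K x) (FX \<Otimes>\<^sub>M FY) (Pair x)"
  have N: "?N \<in> measurable PX (subprob_algebra (FX \<Otimes>\<^sub>M FY))"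
    by (rule measurable_distr2[where M = FY]) measurable
  \<comment> \<open>\<open>\<bind>\<close> takes a default value over an empty space.\<close>
  have ne: "space PX \<noteq> {}"
    using prob_space.not_empty[OF prob_PX] .
  have pair: "Pair x \<in> measurable (K x) (FX \<Otimes>\<^sub>M FY)" if "x \<in> space FX" for x
    using that by (simp add: measurable_cong_sets[OF sets_conditional refl])
  have "P = PX \<bind> ?N"
  proof (rule measure_eqI)
    show "sets P = sets (PX \<bind> ?N)"
      using sets_bind[OF sets_kernel[OF N] ne] by (simp add: sets_P ne)
    fix A assume "A \<in> sets P"
    then have A: "A \<in> sets (FX \<Otimes>\<^sub>M FY)"
      by (simp add: sets_P)
    then have "emeasure P A = (\<integral>\<^sup>+x. emeasure (K x) (Pair x -` A) \<partial>PX)"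
      using cond by (simp add: is_conditional_def)
    also have "\<dots> = (\<integral>\<^sup>+x. emeasure (?N x) A \<partial>PX)"
    proof (rule nn_integral_cong)
      fix x assume "x \<in> space PX"
      then have x: "x \<in> space FX" by simp
      \<comment> \<open>The definition of \<open>is_conditional\<close> does not cut the preimage
        down to the space; for measurable \<open>A\<close> it lies inside anyway.\<close>
      have "Pair x -` A \<inter> space (K x) = Pair x -` A"
        using sets.sets_into_space[OF A] x by (auto simp: space_conditional space_pair_measure)
      then show "emeasure (K x) (Pair x -` A) = emeasure (?N x) A"
        using emeasure_distr[OF pair[OF x] A] by simp
    qed
    also have "\<dots> = emeasure (PX \<bind> ?N) A"
      using emeasure_bind[OF ne N A] by simp
    finally show "emeasure P A = emeasure (PX \<bind> ?N) A" .
  qed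
  then have "(\<integral>\<^sup>+z. f z \<partial>P) = (\<integral>\<^sup>+x. \<integral>\<^sup>+z. f z \<partial>?N x \<partial>PX)"
    using nn_integral_bind[OF f N] by simp
  also have "\<dots> = (\<integral>\<^sup>+x. \<integral>\<^sup>+y. f (x, y) \<partial>K x \<partial>PX)"
    by (intro nn_integral_cong) (simp add: nn_integral_distr pair)
  finally show ?thesis .
qed

lemma nn_integral_marginal:
  assumes [measurable]: "f \<in> borel_measurable FX"
  shows "(\<integral>\<^sup>+x. f x \<partial>PX) = (\<integral>\<^sup>+z. f (fst z) \<partial>P)"
  unfolding marginal_X_def by (rule nn_integral_distr) measurable

end

section \<open>The chain rule\<close>

locale disintegrated_pair = P: disintegrated FX FY P K + Q: disintegrated FX FY Q L
  for FX :: "'x measure" and FY :: "'y measure" and P Q K L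
begin

text \<open>A set is null for a marginal exactly if the cylinder over it is null for the joint
  law.\<close>

lemma absolutely_continuous_marginal:
  assumes "absolutely_continuous Q P"
  shows "absolutely_continuous Q.PX P.PX"
  unfolding absolutely_continuous_def
proof
  fix A assume A: "A \<in> null_sets Q.PX"
  then have [measurable]: "A \<in> sets FX"
    by auto
  have "fst -` A \<inter> space Q \<in> null_sets Q"
    using A by (auto simp: marginal_X_def null_sets_def emeasure_distr)
  then have "fst -` A \<inter> space Q \<in> null_sets P"
    using assms by (auto simp: absolutely_continuous_def)
  moreover have "space P = space Q"
    by (rule sets_eq_imp_space_eq) (simp add: P.sets_P Q.sets_P)
  ultimately show "A \<in> null_sets P.PX"
    by (auto simp: marginal_X_def null_sets_def emeasure_distr)
qed

lemma kl_div_kernel_nonneg: "x \<in> space FX \<Longrightarrow> 0 \<le> kl_div (K x) (L x)"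
  by (intro kl_div_nonneg P.prob_conditional Q.prob_conditional) (simp_all add: P.sets_conditional Q.sets_conditional)

text \<open>The divergences are nonnegative, so the subtracted part of \<open>eintegral\<close>
  vanishes.\<close>

lemma eintegral_kl_div_kernel:
  "eintegral P.PX (\<lambda>x. kl_div (K x) (L x)) = enn2ereal (\<integral>\<^sup>+x. e2ennreal (kl_div (K x) (L x)) \<partial>P.PX)"
  by (rule eintegral_nonneg_fun) (auto simp: kl_div_kernel_nonneg)

text \<open>
  A \<open>Q\<close>-null set charged by \<open>P\<close> has \<open>L x\<close>-null sections for almost every \<open>x\<close>, while \<open>K x\<close> charges
  its sections for a non-null set of \<open>x\<close>.
\<close>

lemma eintegral_kl_div_kernel_singular:
  assumes ac: "absolutely_continuous Q.PX P.PX" and nac: "\<not> absolutely_continuous Q P"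
  shows "eintegral P.PX (\<lambda>x. kl_div (K x) (L x)) = \<infinity>"
proof -
  obtain N where N: "N \<in> null_sets Q" "N \<notin> null_sets P"
    using nac by (auto simp: absolutely_continuous_def)
  then have N_sets [measurable]: "N \<in> sets (FX \<Otimes>\<^sub>M FY)"
    by (auto simp: null_sets_def Q.sets_P)
  have pos: "emeasure P N \<noteq> 0"
    using N N_sets by (auto simp: null_sets_def P.sets_P)
  \<comment> \<open>The masses that \<open>K x\<close> and \<open>L x\<close> give to the section of
    \<open>N\<close> at \<open>x\<close>.\<close>
  let ?k = "\<lambda>x. \<integral>\<^sup>+y. indicator N (x, y) \<partial>K x" and ?l = "\<lambda>x. \<integral>\<^sup>+y. indicator N (x, y) \<partial>L x"
  have k [measurable]: "?k \<in> borel_measurable FX" and l [measurable]: "?l \<in> borel_measurable FX"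
    by (auto intro!: P.measurable_nn_integral_kernel Q.measurable_nn_integral_kernel)
  have "(\<integral>\<^sup>+x. ?l x \<partial>Q.PX) = emeasure Q N"
    using N by (subst Q.nn_integral_disintegrate[symmetric]) auto
  also have "\<dots> = 0"
    using N by auto
  finally have "AE x in Q.PX. ?l x = 0"
    by (subst (asm) nn_integral_0_iff_AE) auto
  then have l0: "AE x in P.PX. ?l x = 0"
    by (intro absolutely_continuous_AE[OF _ ac]) auto
  have sec: "indicator N (x, y) = (indicator (Pair x -` N) y :: ennreal)" for x y
    by (auto simp: indicator_def)
  have top: "kl_div (K x) (L x) = \<infinity>" if x: "x \<in> space FX" and "?l x = 0" "?k x \<noteq> 0" for x
  proof -
    have S: "Pair x -` N \<in> sets FY"
      by (rule sets_Pair1) (rule N_sets)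
    have "Pair x -` N \<in> null_sets (L x)" "Pair x -` N \<notin> null_sets (K x)"
      using that S by (auto simp: null_sets_def sec P.sets_conditional Q.sets_conditional)
    then have "\<not> absolutely_continuous (L x) (K x)"
      by (auto simp: absolutely_continuous_def)
    then show ?thesis
      by (simp add: kl_div_def)
  qed
  have "(\<integral>\<^sup>+x. ?k x \<partial>P.PX) = emeasure P N"
    by (subst P.nn_integral_disintegrate[symmetric]) (auto simp: P.sets_P)
  also have "\<dots> \<noteq> 0"
    by (rule pos)
  \<comment> \<open>The factor \<open>\<infinity>\<close> turns a nonzero integral into an infinite
    one. Since \<open>\<infinity> * 0 = 0\<close>, the scaled function still lies below the
    divergence where \<open>?k x\<close> vanishes.\<close>
  finally have "(\<integral>\<^sup>+x. \<infinity> * ?k x \<partial>P.PX) = \<infinity>"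
    by (subst nn_integral_cmult) (auto simp: ennreal_top_mult)
  moreover have "(\<integral>\<^sup>+x. \<infinity> * ?k x \<partial>P.PX) \<le> (\<integral>\<^sup>+x. e2ennreal (kl_div (K x) (L x)) \<partial>P.PX)"
  proof (rule nn_integral_mono_AE)
    show "AE x in P.PX. \<infinity> * ?k x \<le> e2ennreal (kl_div (K x) (L x))"
      using l0 AE_space
    proof eventually_elim
      case (elim x)
      then show ?case
        using top[of x] by (cases "?k x = 0") (auto simp: e2ennreal_infty)
    qed
  qed
  ultimately show ?thesis
    by (simp add: eintegral_kl_div_kernel top_unique)
qed

section \<open>Conditional densities and additivity of log-densities\<close>

context
  fixes f :: "'x \<times> 'y \<Rightarrow> real" and g :: "'x \<Rightarrow> real"
  assumes f [measurable]: "f \<in> borel_measurable (FX \<Otimes>\<^sub>M FY)" and f_nonneg: "\<And>z. 0 \<le> f z"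
    and P_density: "P = density Q (\<lambda>z. ennreal (f z))"
    and g [measurable]: "g \<in> borel_measurable FX" and g_nonneg: "\<And>x. 0 \<le> g x"
    and PX_density: "P.PX = density Q.PX (\<lambda>x. ennreal (g x))"
begin

text \<open>Integrated over \<open>A\<close> against the marginal of \<open>Q\<close>, both sides
  give the \<open>P\<close>-mass of the rectangle of \<open>A\<close> and \<open>B\<close>: one by
  disintegrating \<open>P\<close>, the other by disintegrating \<open>Q\<close> after inserting
  \<open>f\<close>. Densities are unique almost everywhere; the null set depends on
  \<open>B\<close>.\<close>

lemma AE_kernel_density_on:
  assumes B [measurable]: "B \<in> sets FY"
  shows "AE x in Q.PX. ennreal (g x) * (\<integral>\<^sup>+y. indicator B y \<partial>K x) =
    (\<integral>\<^sup>+y. ennreal (f (x, y)) * indicator B y \<partial>L x)"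
proof -
  interpret QX: prob_space Q.PX by (rule Q.prob_PX)
  let ?k = "\<lambda>x. \<integral>\<^sup>+y. indicator B y \<partial>K x"
    and ?l = "\<lambda>x. \<integral>\<^sup>+y. ennreal (f (x, y)) * indicator B y \<partial>L x"
  have k [measurable]: "?k \<in> borel_measurable FX"
    using P.measurable_nn_integral_kernel[of "\<lambda>z. indicator B (snd z)"] by simp
  have l [measurable]: "?l \<in> borel_measurable FX"
    using Q.measurable_nn_integral_kernel[of "\<lambda>z. ennreal (f z) * indicator B (snd z)"] by simp
  have "density Q.PX (\<lambda>x. ennreal (g x) * ?k x) = density Q.PX ?l"
  proof (rule measure_eqI)
    fix A assume "A \<in> sets (density Q.PX (\<lambda>x. ennreal (g x) * ?k x))"
    then have A [measurable]: "A \<in> sets FX"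
      by simp
    let ?i = "\<lambda>z. indicator A (fst z) * indicator B (snd z) :: ennreal"
    have "emeasure (density Q.PX (\<lambda>x. ennreal (g x) * ?k x)) A =
        (\<integral>\<^sup>+x. ennreal (g x) * (indicator A x * ?k x) \<partial>Q.PX)"
      by (simp add: emeasure_density ac_simps)
    also have "\<dots> = (\<integral>\<^sup>+x. indicator A x * ?k x \<partial>P.PX)"
      unfolding PX_density by (subst nn_integral_density) auto
    also have "\<dots> = (\<integral>\<^sup>+x. \<integral>\<^sup>+y. ?i (x, y) \<partial>K x \<partial>P.PX)"
      by (intro nn_integral_cong) (simp add: nn_integral_cmult P.sets_conditional)
    also have "\<dots> = (\<integral>\<^sup>+z. ?i z \<partial>P)"
      by (rule P.nn_integral_disintegrate[symmetric]) measurable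
    also have "\<dots> = (\<integral>\<^sup>+z. ennreal (f z) * ?i z \<partial>Q)"
      unfolding P_density by (rule nn_integral_density) measurable
    also have "\<dots> = (\<integral>\<^sup>+x. \<integral>\<^sup>+y. ennreal (f (x, y)) * ?i (x, y) \<partial>L x \<partial>Q.PX)"
      by (rule Q.nn_integral_disintegrate) measurable
    also have "\<dots> = (\<integral>\<^sup>+x. ?l x * indicator A x \<partial>Q.PX)"
      by (intro nn_integral_cong) (auto simp: indicator_def)
    also have "\<dots> = emeasure (density Q.PX ?l) A"
      by (simp add: emeasure_density)
    finally show "emeasure (density Q.PX (\<lambda>x. ennreal (g x) * ?k x)) A = emeasure (density Q.PX ?l) A" .
  qed simp
  then show ?thesis
    by (subst (asm) QX.density_unique_iff) auto
qed

lemma AE_marginal_density_pos: "AE x in P.PX. 0 < g x"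
  by (rule AE_density_pos[OF P.prob_PX Q.prob_PX _ g_nonneg PX_density]) measurable

text \<open>A countable generator yields one null set for all \<open>B\<close>. Dividing by
  \<open>g x\<close> requires passing to the marginal of \<open>P\<close>, for which
  \<open>g\<close> is almost everywhere positive.\<close>

lemma AE_kernel_density:
  assumes "countably_generated FY"
  shows "AE x in P.PX. K x = density (L x) (\<lambda>y. ennreal (f (x, y) / g x))"
proof -
  obtain G where G: "countable G" "G \<subseteq> Pow (space FY)" "Int_stable G" "space FY \<in> G"
    "sets FY = sigma_sets (space FY) G"
    using countably_generated_Int_stable[OF assms] .
  have "AE x in Q.PX. \<forall>B\<in>G. ennreal (g x) * (\<integral>\<^sup>+y. indicator B y \<partial>K x) =
      (\<integral>\<^sup>+y. ennreal (f (x, y)) * indicator B y \<partial>L x)"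
    using G by (subst AE_ball_countable) (auto intro!: AE_kernel_density_on)
  moreover have "absolutely_continuous Q.PX P.PX"
    unfolding PX_density by (rule absolutely_continuousI_density) measurable
  ultimately have "AE x in P.PX. \<forall>B\<in>G. ennreal (g x) * (\<integral>\<^sup>+y. indicator B y \<partial>K x) =
      (\<integral>\<^sup>+y. ennreal (f (x, y)) * indicator B y \<partial>L x)"
    by (intro absolutely_continuous_AE[of P.PX Q.PX]) auto
  then show ?thesis
    using AE_marginal_density_pos AE_space
  proof eventually_elim
    case (elim x)
    then have x: "x \<in> space FX" by simp
    note [measurable_cong] = P.sets_conditional[OF x] Q.sets_conditional[OF x]
    note [measurable] = x
    interpret Kx: prob_space "K x" using x by (rule P.prob_conditional)
    have eq: "emeasure (K x) B = emeasure (density (L x) (\<lambda>y. ennreal (f (x, y) / g x))) B"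
      if "B \<in> G" for B
    proof -
      have B [measurable]: "B \<in> sets FY"
        using G(5) that by auto
      have "(\<lambda>y. ennreal (f (x, y) / g x)) \<in> borel_measurable FY"
        "(\<lambda>y. ennreal (f (x, y)) * indicator B y) \<in> borel_measurable FY"
        by measurable
      then have h: "(\<lambda>y. ennreal (f (x, y) / g x)) \<in> borel_measurable (L x)" "B \<in> sets (L x)"
        and fB: "(\<lambda>y. ennreal (f (x, y)) * indicator B y) \<in> borel_measurable (L x)"
        by (simp_all add: measurable_cong_sets[OF Q.sets_conditional[OF x] refl] Q.sets_conditional[OF x])
      have "emeasure (density (L x) (\<lambda>y. ennreal (f (x, y) / g x))) B =
          (\<integral>\<^sup>+y. ennreal (1 / g x) * (ennreal (f (x, y)) * indicator B y) \<partial>L x)"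
        using f_nonneg g_nonneg
        unfolding emeasure_density[OF h]
        by (auto simp: mult.assoc[symmetric] simp flip: ennreal_mult)
      also have "\<dots> = ennreal (1 / g x) * (\<integral>\<^sup>+y. ennreal (f (x, y)) * indicator B y \<partial>L x)"
        by (rule nn_integral_cmult[OF fB])
      also have "\<dots> = ennreal (1 / g x) * (ennreal (g x) * (\<integral>\<^sup>+y. indicator B y \<partial>K x))"
        using bspec[OF elim(1) that] by (simp only:)
      also have "\<dots> = ennreal (1 / g x * g x) * emeasure (K x) B"
        using g_nonneg by (subst ennreal_mult) (auto simp: mult.assoc P.sets_conditional[OF x])
      also have "\<dots> = emeasure (K x) B"
        using elim by simp
      finally show ?thesis ..
    qed
    \<comment> \<open>Measures agreeing on the \<inter>-stable \<open>G\<close> coincide; the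
      exhausting sequence is constantly \<open>space FY\<close>, of mass 1 under
      \<open>K x\<close>.\<close>
    show ?case
    proof (rule measure_eqI_generator_eq[OF G(3,2) eq, where A = "\<lambda>_. space FY"])
      show "sets (K x) = sigma_sets (space FY) G"
        "sets (density (L x) (\<lambda>y. ennreal (f (x, y) / g x))) = sigma_sets (space FY) G"
        by (simp_all add: P.sets_conditional[OF x] Q.sets_conditional[OF x] G(5))
    qed (use G(4) in auto)
  qed
qed

text \<open>All three terms become integrals over \<open>P\<close>, of the logarithms of
  \<open>f\<close>, of \<open>g\<close> after \<open>fst\<close>, and of their quotient. In additive
  form the rule also covers infinite divergences.\<close>

lemma kl_div_joint_eq:
  assumes cg: "countably_generated FY"
  shows "kl_div P Q = kl_div P.PX Q.PX + eintegral P.PX (\<lambda>x. kl_div (K x) (L x))"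
proof -
  let ?h = "\<lambda>z. f z / g (fst z)"
  let ?p = "\<lambda>x. \<integral>\<^sup>+y. ennreal (ln (?h (x, y))) \<partial>K x"
    and ?n = "\<lambda>x. \<integral>\<^sup>+y. ennreal (- ln (?h (x, y))) \<partial>K x"
  interpret PX: prob_space P.PX by (rule P.prob_PX)
  have p [measurable]: "?p \<in> borel_measurable FX" and n [measurable]: "?n \<in> borel_measurable FX"
    by (rule P.measurable_nn_integral_kernel, measurable)+
  \<comment> \<open>For fixed \<open>x\<close> the quotient is a density of \<open>K x\<close> with
    respect to \<open>L x\<close>, so the bounds on log-densities apply fibrewise.\<close>
  have kernel: "AE x in P.PX. e2ennreal (kl_div (K x) (L x)) = ?p x - ?n x \<and> ?n x \<le> ?p x \<and> ?n x \<le> 1"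
    using AE_kernel_density[OF cg] AE_space
  proof eventually_elim
    case (elim x)
    then have x: "x \<in> space FX" by simp
    have h: "(\<lambda>y. ?h (x, y)) \<in> borel_measurable (L x)"
      using x by (subst measurable_cong_sets[OF Q.sets_conditional[OF x] refl]) measurable
    have h0: "0 \<le> ?h (x, y)" for y
      using f_nonneg g_nonneg by simp
    have d: "K x = density (L x) (\<lambda>y. ennreal (?h (x, y)))"
      using elim by simp
    note h = P.prob_conditional[OF x] Q.prob_conditional[OF x] h h0 d
    have le: "?n x \<le> ?p x" and le1: "?n x \<le> 1"
      using nn_integral_ln_density_neg_le_pos[OF h] nn_integral_ln_density_neg[OF h] by auto
    have "kl_div (K x) (L x) = enn2ereal (?p x - ?n x)"
      unfolding kl_div_density[OF h] eintegral_ereal_def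
      using le le1 by (subst enn2ereal_diff) (auto simp: top_unique)
    then show ?case
      using le le1 by simp
  qed
  have n_le: "(\<integral>\<^sup>+x. ?n x \<partial>P.PX) \<le> (\<integral>\<^sup>+x. 1 \<partial>P.PX)" and np: "(\<integral>\<^sup>+x. ?n x \<partial>P.PX) \<le> (\<integral>\<^sup>+x. ?p x \<partial>P.PX)"
    by (rule nn_integral_mono_AE, use kernel in eventually_elim, simp)+
  have n_fin: "(\<integral>\<^sup>+x. ?n x \<partial>P.PX) \<noteq> \<infinity>"
    using n_le by (auto simp: PX.emeasure_space_1 top_unique)
  have P_h: "(\<integral>\<^sup>+z. ennreal (ln (?h z)) \<partial>P) = (\<integral>\<^sup>+x. ?p x \<partial>P.PX)"
    "(\<integral>\<^sup>+z. ennreal (- ln (?h z)) \<partial>P) = (\<integral>\<^sup>+x. ?n x \<partial>P.PX)"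
    by (rule P.nn_integral_disintegrate, measurable)+
  \<comment> \<open>The divergence is exchanged almost everywhere for a difference of measurable
    functions, whose integral splits because \<open>?n\<close> is integrable and below
    \<open>?p\<close>.\<close>
  have "(\<integral>\<^sup>+x. e2ennreal (kl_div (K x) (L x)) \<partial>P.PX) = (\<integral>\<^sup>+x. ?p x - ?n x \<partial>P.PX)"
    by (rule nn_integral_cong_AE, use kernel in eventually_elim, simp)
  also have "\<dots> = (\<integral>\<^sup>+x. ?p x \<partial>P.PX) - (\<integral>\<^sup>+x. ?n x \<partial>P.PX)"
    using kernel p n by (intro nn_integral_diff n_fin)
      (auto simp: measurable_cong_sets[OF P.sets_PX refl])
  finally have C: "eintegral P.PX (\<lambda>x. kl_div (K x) (L x)) = eintegral P (\<lambda>z. ereal (ln (?h z)))"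
    unfolding eintegral_kl_div_kernel eintegral_ereal_def P_h
    by (simp only: enn2ereal_diff[OF np n_fin])
  have gQ: "g \<in> borel_measurable Q.PX" and fQ: "f \<in> borel_measurable Q"
    by measurable
  note X = P.prob_PX Q.prob_PX gQ g_nonneg PX_density
  have X_P: "(\<integral>\<^sup>+x. ennreal (ln (g x)) \<partial>P.PX) = (\<integral>\<^sup>+z. ennreal (ln (g (fst z))) \<partial>P)"
    "(\<integral>\<^sup>+x. ennreal (- ln (g x)) \<partial>P.PX) = (\<integral>\<^sup>+z. ennreal (- ln (g (fst z))) \<partial>P)"
    by (rule P.nn_integral_marginal, measurable)+
  have B: "kl_div P.PX Q.PX = eintegral P (\<lambda>z. ereal (ln (g (fst z))))"
    unfolding kl_div_density[OF X] eintegral_ereal_def X_P ..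
  have "AE z in P. 0 < f z"
    by (rule AE_density_pos[OF P.prob Q.prob fQ f_nonneg P_density])
  moreover have "AE z in P. 0 < g (fst z)"
    using AE_marginal_density_pos unfolding marginal_X_def by (subst (asm) AE_distr_iff) auto
  \<comment> \<open>As \<open>ln 0 = 0\<close>, the identity can fail where \<open>f\<close> or
    \<open>g\<close> vanishes; both exceptional sets are \<open>P\<close>-null.\<close>
  ultimately have "AE z in P. ln (f z) = ln (g (fst z)) + ln (?h z)"
    by eventually_elim (simp add: ln_div)
  then have "eintegral P (\<lambda>z. ereal (ln (f z))) =
      eintegral P (\<lambda>z. ereal (ln (g (fst z)))) + eintegral P (\<lambda>z. ereal (ln (?h z)))"
    using n_fin nn_integral_ln_density_neg[OF X]
    by (intro eintegral_add) (auto simp: P_h X_P top_unique)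
  then show ?thesis
    unfolding B C kl_div_density[OF P.prob Q.prob fQ f_nonneg P_density] .
qed

end

text \<open>The subtracted form of the rule; \<open>fin\<close> rules out
  \<open>\<infinity> - \<infinity>\<close> on the left.\<close>

theorem kl_div_chain_rule:
  assumes cg: "countably_generated FY"
    and fin: "\<not> (kl_div P Q = \<infinity> \<and> kl_div P.PX Q.PX = \<infinity>)"
  shows "kl_div P Q - kl_div P.PX Q.PX = eintegral P.PX (\<lambda>x. kl_div (K x) (L x))"
proof (cases "absolutely_continuous Q P")
  case True
  obtain f :: "'x \<times> 'y \<Rightarrow> real" where f: "f \<in> borel_measurable Q" "\<And>z. 0 \<le> f z"
    "P = density Q (\<lambda>z. ennreal (f z))"
    using prob_density_exists[OF P.prob Q.prob _ True] by (metis P.sets_P Q.sets_P)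
  obtain g :: "'x \<Rightarrow> real" where g: "g \<in> borel_measurable Q.PX" "\<And>x. 0 \<le> g x"
    "P.PX = density Q.PX (\<lambda>x. ennreal (g x))"
    using prob_density_exists[OF P.prob_PX Q.prob_PX _ absolutely_continuous_marginal[OF True]]
    by (metis P.sets_PX Q.sets_PX)
  have sum: "kl_div P Q = kl_div P.PX Q.PX + eintegral P.PX (\<lambda>x. kl_div (K x) (L x))"
    using f g by (intro kl_div_joint_eq[OF _ _ _ _ _ _ cg]) (auto cong: measurable_cong_sets simp: Q.sets_P)
  moreover have "0 \<le> kl_div P.PX Q.PX"
    by (intro kl_div_nonneg P.prob_PX Q.prob_PX) simp
  \<comment> \<open>By \<open>sum\<close>, an infinite marginal divergence would force an infinite
    joint one, against \<open>fin\<close>; a finite one cancels.\<close>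
  ultimately show ?thesis
    using fin
    by (cases "kl_div P.PX Q.PX"; cases "eintegral P.PX (\<lambda>x. kl_div (K x) (L x))") auto
next
  case False
  then have top: "kl_div P Q = \<infinity>"
    by (simp add: kl_div_def)
  with fin have "kl_div P.PX Q.PX \<noteq> \<infinity>"
    by simp
  then have "absolutely_continuous Q.PX P.PX"
    by (auto simp: kl_div_def split: if_splits)
  with False have "eintegral P.PX (\<lambda>x. kl_div (K x) (L x)) = \<infinity>"
    by (intro eintegral_kl_div_kernel_singular)
  then show ?thesis
    by (simp add: top)
qed

end

section \<open>Forward and reversed path measures\<close>

theorem proposition2:
  fixes T :: real
    and \<Omega> :: "'w measure"
    and SX :: "'a measure" and SY :: "'b measure"
    and FX :: "(real \<Rightarrow> 'a) measure" and FY :: "(real \<Rightarrow> 'b) measure"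
    and X :: "real \<Rightarrow> 'w \<Rightarrow> 'a" and Y :: "real \<Rightarrow> 'w \<Rightarrow> 'b"
    and RXY :: "((real \<Rightarrow> 'a) \<times> (real \<Rightarrow> 'b)) measure"
    and RX :: "(real \<Rightarrow> 'a) measure"
    and K KR :: "(real \<Rightarrow> 'a) \<Rightarrow> (real \<Rightarrow> 'b) measure"
    and PXY PRXY :: "((real \<Rightarrow> 'a) \<times> (real \<Rightarrow> 'b)) measure"
    and PX PRX :: "(real \<Rightarrow> 'a) measure"
    and \<Sigma>XY \<Sigma>X \<Sigma>hidden :: ereal
  assumes "path_space T SX FX" and "path_space T SY FY"
    and "countably_generated FY"
    and "prob_space \<Omega>"
    and "trajectory T X \<in> measurable \<Omega> FX" and "trajectory T Y \<in> measurable \<Omega> FY"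
  defines "PXY \<equiv> joint_path_measure T \<Omega> FX FY X Y"
    and "PRXY \<equiv> reversed_measure T PXY"
    and "PX \<equiv> marginal_X FX PXY"
    and "PRX \<equiv> marginal_X FX PRXY"
    and "\<Sigma>XY \<equiv> kl_div PXY PRXY"
    and "\<Sigma>X \<equiv> kl_div PX PRX"
    and "\<Sigma>hidden \<equiv> \<Sigma>XY - \<Sigma>X"
  assumes "has_density_wrt PXY RXY" and "has_density_wrt PRXY RXY"
    and "has_density_wrt PX RX" and "has_density_wrt PRX RX"
    and "is_conditional FX FY PXY K" and "is_conditional FX FY PRXY KR"
    and "\<not> (\<Sigma>XY = \<infinity> \<and> \<Sigma>X = \<infinity>)"
  shows "\<Sigma>hidden = eintegral PX (\<lambda>\<gamma>. kl_div (K \<gamma>) (KR \<gamma>)) \<and>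
         eintegral PX (\<lambda>\<gamma>. kl_div (K \<gamma>) (KR \<gamma>)) \<ge> 0"
proof -
  interpret EX: path_space T SX FX by fact
  interpret EY: path_space T SY FY by fact
  note [measurable] = EX.measurable_reversal EY.measurable_reversal
    \<open>trajectory T X \<in> measurable \<Omega> FX\<close> \<open>trajectory T Y \<in> measurable \<Omega> FY\<close>
  have sets_P [measurable_cong]: "sets PXY = sets (FX \<Otimes>\<^sub>M FY)"
    by (simp add: PXY_def joint_path_measure_def)
  have P: "prob_space PXY"
    unfolding PXY_def joint_path_measure_def
    by (rule prob_space.prob_space_distr[OF \<open>prob_space \<Omega>\<close>]) measurable
  \<comment> \<open>Measurability of the reversal on both path spaces makes the reversed law a
    probability measure.\<close>
  have "map_prod (time_reversal T) (time_reversal T) \<in> measurable PXY PXY"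
    unfolding map_prod_def by measurable
  then have R: "prob_space PRXY"
    unfolding PRXY_def reversed_measure_def by (rule prob_space.prob_space_distr[OF P])
  have sets_R: "sets PRXY = sets (FX \<Otimes>\<^sub>M FY)"
    by (simp add: PRXY_def reversed_measure_def sets_P)
  interpret disintegrated_pair FX FY PXY PRXY K KR
    using assms P R sets_P sets_R
    by (intro disintegrated_pair.intro disintegrated.intro) auto
  have "\<Sigma>hidden = eintegral PX (\<lambda>\<gamma>. kl_div (K \<gamma>) (KR \<gamma>))"
    using kl_div_chain_rule assms by auto
  \<comment> \<open>The integral is the image of an \<open>ennreal\<close>, hence
    nonnegative.\<close>
  moreover have "0 \<le> eintegral PX (\<lambda>\<gamma>. kl_div (K \<gamma>) (KR \<gamma>))"
    unfolding PX_def eintegral_kl_div_kernel by simp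
  ultimately show ?thesis
    by simp
qed

end
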